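(* Köthe's Problem has a positive answer for any $\mathsf{f}$-commutative ring; that is: let $R$ be an $\mathsf{f}$-commutative ring. If $R$ has no nonzero nil (two-sided) ideals, then $R$ has no nonzero one-sided (left or right) nil ideals.
   Context: Rings are associative, not necessarily with unity. A (one-sided or two-sided) ideal is nil if each of its elements is nilpotent. Köthe's Problem is the assertion "if a ring $R$ has no nonzero nil ideals, then $R$ has no nonzero one-sided nil ideals". A left action of a semigroup $\mathfrak{S}$ on a ring $R$ is a map $\mathfrak{S}\times R\to R$, $(\lambda,x)\mapsto\lambda\cdot x$, with $(\lambda\gamma)\cdot x=\lambda\cdot(\gamma\cdot x)$ and $\lambda\cdot(xy)=(\lambda\cdot x)y$ for all $\lambda,\gamma\in\mathfrak{S}$, $x,y\in R$. A ring $R$ is $\mathsf{f}$-commutative if there exist a semigroup $\mathfrak{S}$ acting on the left of $R$ in this sense and a map $\mathsf{f}:R\times R\to\mathfrak{S}$ such that $ab=\mathsf{f}(a,b)\cdot(ba)$ for all $a,b\in R$. *)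

theory Defs
  imports Main
begin

text \<open>
  The type class \<^class>\<open>ring\<close> describes associative rings, not necessarily with unity.
  The library power operation needs a unity, so positive powers are defined here:
  \<open>pos_power x n\<close> is the product of \<open>n + 1\<close> factors \<open>x\<close>.
\<close>

primrec pos_power :: "'a::semigroup_mult \<Rightarrow> nat \<Rightarrow> 'a" where
  "pos_power x 0 = x"
| "pos_power x (Suc n) = pos_power x n * x"

definition nilpotent_elem :: "'a::ring \<Rightarrow> bool" where
  "nilpotent_elem x \<longleftrightarrow> (\<exists>n. pos_power x n = 0)"

definition additive_subgroup :: "'a::ring set \<Rightarrow> bool" where
  "additive_subgroup I \<longleftrightarrow>
     0 \<in> I \<and> (\<forall>x\<in>I. \<forall>y\<in>I. x + y \<in> I) \<and> (\<forall>x\<in>I. - x \<in> I)"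

definition left_ideal :: "'a::ring set \<Rightarrow> bool" where
  "left_ideal I \<longleftrightarrow> additive_subgroup I \<and> (\<forall>r. \<forall>x\<in>I. r * x \<in> I)"

definition right_ideal :: "'a::ring set \<Rightarrow> bool" where
  "right_ideal I \<longleftrightarrow> additive_subgroup I \<and> (\<forall>r. \<forall>x\<in>I. x * r \<in> I)"

definition two_sided_ideal :: "'a::ring set \<Rightarrow> bool" where
  "two_sided_ideal I \<longleftrightarrow> left_ideal I \<and> right_ideal I"

definition nil_set :: "'a::ring set \<Rightarrow> bool" where
  "nil_set I \<longleftrightarrow> (\<forall>x\<in>I. nilpotent_elem x)"

text \<open>No compatibility with addition is required of an action.\<close>

definition left_action :: "('s::semigroup_mult \<Rightarrow> 'a::ring \<Rightarrow> 'a) \<Rightarrow> bool" where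
  "left_action act \<longleftrightarrow>
     (\<forall>l g x. act (l * g) x = act l (act g x)) \<and>
     (\<forall>l x y. act l (x * y) = act l x * y)"

text \<open>
  HOL cannot quantify existentially over the type of the acting semigroup, so
  f-commutativity is a predicate on the witnesses: the ring \<open>'a\<close> is f-commutative iff
  \<open>f_commutative act f\<close> holds for some semigroup \<open>'s\<close>, action \<open>act\<close> and map \<open>f\<close>.
\<close>

definition f_commutative ::
    "('s::semigroup_mult \<Rightarrow> 'a::ring \<Rightarrow> 'a) \<Rightarrow> ('a \<Rightarrow> 'a \<Rightarrow> 's) \<Rightarrow> bool" where
  "f_commutative act f \<longleftrightarrow> left_action act \<and> (\<forall>a b. a * b = act (f a b) (b * a))"

end

theory Submission
  imports Defs
begin

text \<open>
  An action fixes \<open>0\<close>, so an f-commutative ring is reversible: \<open>a b = 0\<close> implies \<open>b a = 0\<close>, and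
  consequently \<open>a R b = 0\<close>. If \<open>y\<^sup>2 = 0\<close>, then the right annihilator \<open>A\<close> of \<open>y\<close> is a two-sided
  ideal, and its intersection with the left annihilator of \<open>A\<close> is an ideal of square zero
  containing \<open>y\<close>. Hence, in the absence of nonzero nil ideals, the ring has no nonzero nilpotent
  elements at all.
\<close>

text \<open>Additivity of the action is not assumed; \<open>0\<close> is instead read as the product
  \<open>0 * 0\<close>, whose right factor the action leaves alone.\<close>

lemma left_action_zero:
  assumes "left_action act"
  shows "act l 0 = 0"
proof -
  have "act l (0 * 0) = act l 0 * 0"
    using assms unfolding left_action_def by blast
  then show ?thesis by simp
qed

lemma f_commutative_reversible:
  fixes a b :: "'a::ring" and act :: "'s::semigroup_mult \<Rightarrow> 'a \<Rightarrow> 'a"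
  assumes "f_commutative act f" and "a * b = 0"
  shows "b * a = 0"
proof -
  have "b * a = act (f b a) (a * b)" and "left_action act"
    using assms(1) unfolding f_commutative_def by blast+
  then show ?thesis using assms(2) left_action_zero by simp
qed

lemma reversible_imp_semicommutative:
  fixes a b r :: "'a::ring"
  assumes rev: "\<And>a b :: 'a. a * b = 0 \<Longrightarrow> b * a = 0" and "a * b = 0"
  shows "a * r * b = 0"
proof -
  have "b * (a * r) = 0"
    using rev[OF \<open>a * b = 0\<close>] by (simp flip: mult.assoc)
  then show ?thesis by (rule rev)
qed

lemma square_zero_in_nil_ideal:
  fixes y :: "'a::ring"
  assumes semi: "\<And>a b r :: 'a. a * b = 0 \<Longrightarrow> a * r * b = 0" and "y * y = 0"
  shows "\<exists>I. two_sided_ideal I \<and> nil_set I \<and> y \<in> I"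
proof -
  define A where "A = {z. y * z = 0}"
  define I where "I = {x \<in> A. \<forall>z\<in>A. x * z = 0}"
  \<comment> \<open>From \<open>y * z = 0\<close>, \<open>semi\<close> inserts \<open>r\<close>
    between the two factors.\<close>
  have A_left: "r * z \<in> A" if "z \<in> A" for r z
    using that semi[of y z r] by (simp add: A_def mult.assoc)
  have A_right: "z * r \<in> A" if "z \<in> A" for r z
    using that by (simp add: A_def flip: mult.assoc)
  have "additive_subgroup I"
    by (simp add: additive_subgroup_def I_def A_def distrib_left distrib_right)
  moreover have "r * x \<in> I" if "x \<in> I" for r x
    using that A_left by (simp add: I_def mult.assoc)
  \<comment> \<open>\<open>x * r\<close> kills each \<open>z\<close> in \<open>A\<close> because
    \<open>r * z\<close> is again in \<open>A\<close>.\<close>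
  moreover have "x * r \<in> I" if "x \<in> I" for r x
    using that A_left A_right by (simp add: I_def mult.assoc)
  ultimately have "two_sided_ideal I"
    by (auto simp: two_sided_ideal_def left_ideal_def right_ideal_def)
  moreover have "nilpotent_elem x" if "x \<in> I" for x
  proof -
    \<comment> \<open>\<open>x\<close> lies in \<open>A\<close> and kills \<open>A\<close>, so
      \<open>x * x = 0\<close>; the exponent \<open>Suc 0\<close> stands for two factors.\<close>
    have "pos_power x (Suc 0) = 0"
      using that by (simp add: I_def)
    then show ?thesis unfolding nilpotent_elem_def by blast
  qed
  moreover have "y \<in> I"
    using \<open>y * y = 0\<close> by (simp add: I_def A_def)
  ultimately show ?thesis unfolding nil_set_def by blast
qed

text \<open>Descent on the exponent: if \<open>?p * x = 0\<close> then \<open>?p * ?p = 0\<close>,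
  so \<open>red\<close> gives \<open>?p = 0\<close>, a vanishing power with one factor
  fewer.\<close>

lemma pos_power_eq_0_imp_eq_0:
  fixes x :: "'a::ring"
  assumes semi: "\<And>a b r :: 'a. a * b = 0 \<Longrightarrow> a * r * b = 0"
    and red: "\<And>y :: 'a. y * y = 0 \<Longrightarrow> y = 0"
    and "pos_power x n = 0"
  shows "x = 0"
  using assms(3)
proof (induction n)
  case 0
  then show ?case by simp
next
  case (Suc n)
  let ?p = "pos_power x n"
  have px: "?p * x = 0"
    using Suc.prems by simp
  have "?p * ?p = 0"
  proof (cases n)
    case 0
    then show ?thesis using px by simp
  next
    case (Suc m)
    \<comment> \<open>The second \<open>?p\<close> is \<open>pos_power x m * x\<close>, so
      \<open>?p * ?p\<close> is \<open>?p * x\<close> with \<open>pos_power x m\<close>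
      inserted.\<close>
    then show ?thesis using semi[OF px, of "pos_power x m"] by (simp add: mult.assoc)
  qed
  then show ?case using red Suc.IH by blast
qed

theorem theorem4p14:
  fixes act :: "'s::semigroup_mult \<Rightarrow> 'a::ring \<Rightarrow> 'a"
    and f :: "'a \<Rightarrow> 'a \<Rightarrow> 's"
  assumes "f_commutative act f"
    and "\<not> (\<exists>I :: 'a set. two_sided_ideal I \<and> nil_set I \<and> I \<noteq> {0})"
  shows "\<not> (\<exists>I :: 'a set. (left_ideal I \<or> right_ideal I) \<and> nil_set I \<and> I \<noteq> {0})"
proof
  have semi: "a * r * b = 0" if "a * b = 0" for a b r :: 'a
    using reversible_imp_semicommutative[OF f_commutative_reversible[OF assms(1)] that] .
  have red: "y = 0" if "y * y = 0" for y :: 'a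
    using square_zero_in_nil_ideal[OF semi that] assms(2) by blast
  assume "\<exists>I :: 'a set. (left_ideal I \<or> right_ideal I) \<and> nil_set I \<and> I \<noteq> {0}"
  then obtain I :: "'a set" where I: "left_ideal I \<or> right_ideal I" "nil_set I" "I \<noteq> {0}"
    by blast
  \<comment> \<open>This rules out the empty set, so \<open>I \<noteq> {0}\<close> yields a nonzero
    element.\<close>
  have "0 \<in> I"
    using I(1) unfolding left_ideal_def right_ideal_def additive_subgroup_def by blast
  then obtain x where "x \<in> I" "x \<noteq> 0"
    using I(3) by blast
  then obtain n where "pos_power x n = 0"
    using I(2) unfolding nil_set_def nilpotent_elem_def by blast
  then have "x = 0"
    using pos_power_eq_0_imp_eq_0[OF semi red] by blast
  then show False using \<open>x \<noteq> 0\<close> by blast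
qed

end
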